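(* Let $G$ be a connected $k$-regular graph with $n$ vertices and adjacency matrix $A(G)$. Then the spectrum of the diminished Sombor matrix $M_{DS}(G)$ is exactly $\frac{\sqrt{2}}{2}$ times the spectrum of $A(G)$ (eigenvalues counted with multiplicity).
   Context: All graphs are finite, simple and undirected. For a graph $G$ with vertices $v_1,\dots,v_n$ and degrees $d_i=d_{v_i}$, the diminished Sombor matrix $M_{DS}(G)=(\mu_{ij})$ is the $n\times n$ real symmetric matrix with $\mu_{ij}=\frac{\sqrt{d_i^2+d_j^2}}{d_i+d_j}$ if $v_iv_j\in E(G)$, and $\mu_{ij}=0$ otherwise. *)

theory Defs
  imports
    Complex_Main
    "HOL-Computational_Algebra.Polynomial"
    "Graph_Theory.Digraph_Component"
    "Jordan_Normal_Form.Char_Poly"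
begin

text \<open>
  A finite simple undirected graph is a digraph satisfying the locale \<^term>\<open>graph\<close>:
  finite, loop-free, without parallel arcs, and with a symmetric arc relation. An undirected
  edge is thus a pair of opposite arcs, and the degree of a vertex is its
  \<^term>\<open>out_degree\<close>.

  The vertices are listed as \<open>v 0, \<dots>, v (n - 1)\<close>, where the theorem requires \<open>v\<close> to be
  a bijection from \<open>{..<n}\<close> to the vertex set; matrix indices start at 0 accordingly.
\<close>

definition regular_graph :: "('a, 'b) pre_digraph \<Rightarrow> nat \<Rightarrow> bool" where
  "regular_graph G k \<longleftrightarrow> (\<forall>u \<in> verts G. out_degree G u = k)"

definition adjacency_matrix :: "('a, 'b) pre_digraph \<Rightarrow> nat \<Rightarrow> (nat \<Rightarrow> 'a) \<Rightarrow> real mat" where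
  "adjacency_matrix G n v = mat n n (\<lambda>(i, j). if v i \<rightarrow>\<^bsub>G\<^esub> v j then 1 else 0)"

definition diminished_sombor_matrix ::
    "('a, 'b) pre_digraph \<Rightarrow> nat \<Rightarrow> (nat \<Rightarrow> 'a) \<Rightarrow> real mat" where
  "diminished_sombor_matrix G n v = mat n n (\<lambda>(i, j).
     if v i \<rightarrow>\<^bsub>G\<^esub> v j
     then sqrt ((real (out_degree G (v i)))\<^sup>2 + (real (out_degree G (v j)))\<^sup>2)
            / (real (out_degree G (v i)) + real (out_degree G (v j)))
     else 0)"

text \<open>
  The spectrum with multiplicities. The roots of the characteristic polynomial are taken over
  the complex numbers, so that no eigenvalue is lost for any real matrix: an \<open>n \<times> n\<close> matrix
  has exactly \<open>n\<close> of them. For the symmetric matrices considered here they are all real, and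
  algebraic and geometric multiplicities coincide.
\<close>

definition spectrum_mset :: "real mat \<Rightarrow> complex multiset" where
  "spectrum_mset A = proots (char_poly (map_mat complex_of_real A))"

end

theory Submission
  imports Defs "Jordan_Normal_Form.Jordan_Normal_Form_Existence"
begin

text \<open>In a k-regular graph both ends of every edge have degree k, so every edge has the same
  weight sqrt(2k^2) / (2k) = sqrt 2 / 2. The diminished Sombor matrix is therefore a scalar multiple
  of the adjacency matrix (\<open>diminished_sombor_matrix_regular\<close>). Multiplying a complex
  matrix by c \<noteq> 0 multiplies each eigenvalue by c and keeps its algebraic multiplicity
  (\<open>proots_char_poly_smult\<close>); \<open>spectrum_mset_smult\<close> carries this over to
  real matrices and their complex spectra.\<close>

lemma (in fin_digraph) out_degree_pos_if_dominates:
  assumes "u \<rightarrow> w"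
  shows "out_degree G u > 0"
proof -
  obtain e where "e \<in> out_arcs G u"
    using assms by (auto simp: arcs_ends_conv)
  then show ?thesis
    using finite_out_arcs by (auto simp: out_degree_def card_gt_0_iff)
qed

lemma sqrt_double_square_div_double:
  fixes x :: real
  assumes "x > 0"
  shows "sqrt (x\<^sup>2 + x\<^sup>2) / (x + x) = sqrt 2 / 2"
proof -
  have "sqrt (x\<^sup>2 + x\<^sup>2) = sqrt (2 * x\<^sup>2)"
    by simp
  also have "\<dots> = sqrt 2 * x"
    using assms by (simp add: real_sqrt_mult)
  finally show ?thesis
    using assms by simp
qed

lemma diminished_sombor_matrix_regular:
  assumes "fin_digraph G" and "regular_graph G k" and "v ` {..<n} \<subseteq> verts G"
  shows "diminished_sombor_matrix G n v = (sqrt 2 / 2) \<cdot>\<^sub>m adjacency_matrix G n v"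
proof (rule eq_matI)
  interpret fin_digraph G by fact
  fix i j
  assume "i < dim_row ((sqrt 2 / 2) \<cdot>\<^sub>m adjacency_matrix G n v)"
    and "j < dim_col ((sqrt 2 / 2) \<cdot>\<^sub>m adjacency_matrix G n v)"
  then have ij: "i < n" "j < n"
    by (auto simp: adjacency_matrix_def)
  then have deg: "out_degree G (v i) = k" "out_degree G (v j) = k"
    using assms by (auto simp: regular_graph_def)
  show "diminished_sombor_matrix G n v $$ (i, j)
      = ((sqrt 2 / 2) \<cdot>\<^sub>m adjacency_matrix G n v) $$ (i, j)"
  proof (cases "v i \<rightarrow>\<^bsub>G\<^esub> v j")
    case True
    \<comment> \<open>The edge itself forces k > 0, so the weight is a genuine quotient and not 0 /
      0. For k = 0 there are no edges, and only the other case occurs.\<close>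
    then have "real k > 0"
      using out_degree_pos_if_dominates deg by fastforce
    from sqrt_double_square_div_double[OF this] show ?thesis
      using True ij by (simp add: diminished_sombor_matrix_def adjacency_matrix_def deg)
  next
    case False
    then show ?thesis
      using ij by (simp add: diminished_sombor_matrix_def adjacency_matrix_def)
  qed
qed (simp_all add: diminished_sombor_matrix_def adjacency_matrix_def)

lemma count_image_mset_inj_apply:
  assumes "inj f"
  shows "count (image_mset f M) (f x) = count M x"
  using assms by (induction M) (auto simp: inj_eq)

text \<open>Two multisets agree if all multiplicities do. The order of x as a root of the
  characteristic polynomial of cA is the order of x / c for A
  (\<open>order_char_poly_smult\<close>), and x / c is the only preimage of x under multiplication
  by c.\<close>

lemma proots_char_poly_smult:
  fixes A :: "complex mat"
  assumes A: "A \<in> carrier_mat n n" and c: "c \<noteq> 0"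
  shows "proots (char_poly (c \<cdot>\<^sub>m A)) = image_mset ((*) c) (proots (char_poly A))"
proof (rule multiset_eqI)
  fix x
  \<comment> \<open>Multiplicity in \<open>proots\<close> is the root order only for a nonzero
    polynomial; characteristic polynomials are monic.\<close>
  have nz: "char_poly B \<noteq> 0" if "B \<in> carrier_mat n n" for B :: "complex mat"
    using degree_monic_char_poly[OF that] by auto
  \<comment> \<open>Writing x as c * (x / c) exhibits it as a value of the injective map, so that
    its count can be read off at x / c.\<close>
  have "count (image_mset ((*) c) (proots (char_poly A))) (c * (x / c))
      = count (proots (char_poly A)) (x / c)"
    using c by (intro count_image_mset_inj_apply) (simp add: inj_on_def)
  then show "count (proots (char_poly (c \<cdot>\<^sub>m A))) x
      = count (image_mset ((*) c) (proots (char_poly A))) x"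
    using nz[of A] nz[of "c \<cdot>\<^sub>m A"] A c by (simp add: order_char_poly_smult[OF A c])
qed

lemma spectrum_mset_smult:
  assumes A: "A \<in> carrier_mat n n" and c: "c \<noteq> 0"
  shows "spectrum_mset (c \<cdot>\<^sub>m A) = image_mset ((*) (complex_of_real c)) (spectrum_mset A)"
proof -
  have "map_mat complex_of_real (c \<cdot>\<^sub>m A)
      = complex_of_real c \<cdot>\<^sub>m map_mat complex_of_real A"
    by (rule eq_matI) auto
  moreover have "map_mat complex_of_real A \<in> carrier_mat n n"
    using A by simp
  ultimately show ?thesis
    using c by (simp add: spectrum_mset_def proots_char_poly_smult)
qed

theorem theorem3p1:
  fixes G :: "('a, 'b) pre_digraph" and v :: "nat \<Rightarrow> 'a" and n k :: nat
  assumes "graph G"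
    and "Digraph_Component.connected G"
    and "regular_graph G k"
    and "bij_betw v {..<n} (verts G)"
  shows "spectrum_mset (diminished_sombor_matrix G n v)
         = image_mset (\<lambda>x. complex_of_real (sqrt 2 / 2) * x) (spectrum_mset (adjacency_matrix G n v))"
proof -
  interpret graph G by fact
  have "diminished_sombor_matrix G n v = (sqrt 2 / 2) \<cdot>\<^sub>m adjacency_matrix G n v"
    using assms(3,4) by (intro diminished_sombor_matrix_regular fin_digraph)
      (auto simp: bij_betw_def)
  moreover have "adjacency_matrix G n v \<in> carrier_mat n n"
    by (simp add: adjacency_matrix_def)
  moreover have "sqrt 2 / 2 \<noteq> (0 :: real)"
    by simp
  ultimately show ?thesis
    by (metis spectrum_mset_smult)
qed

end
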